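(* There are planar undirected edge-weighted graphs of arbitrarily large size $n$ (number of vertices) such that, for each such graph, the cycles of every minimum cycle basis of the graph have total length $\Omega(n^2)$.
   Context: Let $G=(V,E)$ be an undirected graph with real edge weights $w:E\to\mathbb R$. To each simple cycle $C$ of $G$ associate its incidence vector $x\in\mathrm{GF}(2)^E$ ($x_e=1$ iff $e\in C$). A set of simple cycles is independent if their incidence vectors are linearly independent over $\mathrm{GF}(2)$; the cycle space is the span of all such vectors, and a cycle basis is a maximal independent set of simple cycles (it has $m-n+c$ cycles, where $m=|E|$, $n=|V|$, $c$ the number of connected components). The weight of a cycle is the sum of the weights of its edges; a minimum cycle basis (MCB) is a cycle basis of minimum total weight. The length of a cycle is its number of edges, and the total length of a set of cycles is the sum of their lengths. *)

theory Defs
  imports "HOL-Analysis.Analysis" "HOL-Library.Z2" "HOL-Library.Function_Algebras"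
begin

type_synonym 'a edge = "'a set"

definition simple_graph :: "'a set \<Rightarrow> 'a edge set \<Rightarrow> bool" where
  "simple_graph V E \<longleftrightarrow> finite V \<and> (\<forall>e\<in>E. e \<subseteq> V \<and> card e = 2)"

definition plane_embedding ::
    "'a set \<Rightarrow> 'a edge set \<Rightarrow> ('a \<Rightarrow> complex) \<Rightarrow> ('a edge \<Rightarrow> real \<Rightarrow> complex) \<Rightarrow> bool" where
  "plane_embedding V E p \<gamma> \<longleftrightarrow>
     inj_on p V \<and>
     (\<forall>e\<in>E. arc (\<gamma> e) \<and> {pathstart (\<gamma> e), pathfinish (\<gamma> e)} = p ` e \<and>
            path_image (\<gamma> e) \<inter> p ` V = p ` e) \<and>
     (\<forall>e\<in>E. \<forall>e'\<in>E. e \<noteq> e' \<longrightarrow> path_image (\<gamma> e) \<inter> path_image (\<gamma> e') = p ` (e \<inter> e'))"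

definition planar :: "'a set \<Rightarrow> 'a edge set \<Rightarrow> bool" where
  "planar V E \<longleftrightarrow> (\<exists>p \<gamma>. plane_embedding V E p \<gamma>)"

text \<open>A simple cycle is represented by its edge set; \<open>vs\<close> lists its vertices in cyclic order.\<close>

definition closed_walk_edges :: "'a list \<Rightarrow> 'a edge set" where
  "closed_walk_edges vs = {{vs ! i, vs ! (Suc i mod length vs)} | i. i < length vs}"

definition simple_cycle :: "'a set \<Rightarrow> 'a edge set \<Rightarrow> 'a edge set \<Rightarrow> bool" where
  "simple_cycle V E C \<longleftrightarrow>
     (\<exists>vs. length vs \<ge> 3 \<and> distinct vs \<and> set vs \<subseteq> V \<and> closed_walk_edges vs \<subseteq> E \<and>
           C = closed_walk_edges vs)"

text \<open>
  Vectors in \<open>GF(2)\<^sup>E\<close> are represented by functions from all possible edges to \<^typ>\<open>bit\<close>;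
  the incidence vector of a cycle of the graph vanishes outside \<open>E\<close>.
\<close>

definition incidence_vector :: "'a edge set \<Rightarrow> 'a edge \<Rightarrow> bit" where
  "incidence_vector C = (\<lambda>e. if e \<in> C then 1 else 0)"

interpretation gf2: vector_space "\<lambda>(c::bit) (x :: 'b \<Rightarrow> bit) e. c * x e"
  by unfold_locales (auto simp: fun_eq_iff plus_fun_def algebra_simps)

definition independent_cycles :: "'a set \<Rightarrow> 'a edge set \<Rightarrow> 'a edge set set \<Rightarrow> bool" where
  "independent_cycles V E B \<longleftrightarrow>
     (\<forall>C\<in>B. simple_cycle V E C) \<and> gf2.independent (incidence_vector ` B)"

definition cycle_basis :: "'a set \<Rightarrow> 'a edge set \<Rightarrow> 'a edge set set \<Rightarrow> bool" where
  "cycle_basis V E B \<longleftrightarrow>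
     independent_cycles V E B \<and> (\<forall>B'. independent_cycles V E B' \<and> B \<subseteq> B' \<longrightarrow> B' = B)"

definition total_weight :: "('a edge \<Rightarrow> real) \<Rightarrow> 'a edge set set \<Rightarrow> real" where
  "total_weight w B = (\<Sum>C\<in>B. \<Sum>e\<in>C. w e)"

definition total_length :: "'a edge set set \<Rightarrow> nat" where
  "total_length B = (\<Sum>C\<in>B. card C)"

definition minimum_cycle_basis ::
    "'a set \<Rightarrow> 'a edge set \<Rightarrow> ('a edge \<Rightarrow> real) \<Rightarrow> 'a edge set set \<Rightarrow> bool" where
  "minimum_cycle_basis V E w B \<longleftrightarrow>
     cycle_basis V E B \<and> (\<forall>B'. cycle_basis V E B' \<longrightarrow> total_weight w B \<le> total_weight w B')"

end

theory Submission imports Defs begin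

text \<open>
  Join two vertices \<open>s\<close>, \<open>t\<close> by a path \<open>P\<close> with \<open>n\<close> edges of weight \<open>0\<close> and by \<open>n\<close> internally
  disjoint paths \<open>Q\<^sub>1, \<dots>, Q\<^sub>n\<close> with two edges of weight \<open>1\<close> each. Every simple cycle is the union
  of two of these \<open>s\<close>-\<open>t\<close>-paths. The cycles \<open>P \<union> Q\<^sub>j\<close> have weight \<open>2\<close> and form a cycle basis,
  whereas \<open>Q\<^sub>i \<union> Q\<^sub>j\<close> has weight \<open>4\<close>; hence they form the only minimum cycle basis, although each
  of them has length \<open>n + 2\<close>.
\<close>

section \<open>Simple cycles and cycle bases in an arbitrary graph\<close>

text \<open>In the cyclic order, \<open>v\<close> lies exactly on the edge to its successor and the
  edge from its predecessor. Classifying the cycles below rests on these degrees alone, not on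
  vertex lists.\<close>

lemma simple_cycle_degree:
  assumes "simple_cycle V E C" "e \<in> C" "v \<in> e"
  shows "card {d \<in> C. v \<in> d} = 2"
proof -
  obtain vs where vs: "length vs \<ge> 3" "distinct vs" "C = closed_walk_edges vs"
    using assms(1) unfolding simple_cycle_def by blast
  define k where "k = length vs"
  have k: "k \<ge> 3" using vs k_def by simp
  have C: "C = {{vs ! i, vs ! (Suc i mod k)} | i. i < k}"
    unfolding vs(3) closed_walk_edges_def k_def by simp
  have inj: "vs ! i = vs ! j \<longleftrightarrow> i = j" if "i < k" "j < k" for i j
    using vs(2) that nth_eq_iff_index_eq unfolding k_def by blast
  have lt: "Suc i mod k < k" for i using k by simp
  obtain j where j: "j < k" "v = vs ! j"
  proof -
    obtain i where "i < k" "e = {vs ! i, vs ! (Suc i mod k)}" using assms(2) C by blast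
    thus thesis using assms(3) that lt by blast
  qed
  \<comment> \<open>\<open>j'\<close> is the cyclic predecessor of \<open>j\<close>; index 0 wraps
    around to \<open>k - 1\<close>.\<close>
  define j' where "j' = (if j = 0 then k - 1 else j - 1)"
  have j': "j' < k" using j k by (auto simp: j'_def)
  have pred: "Suc i mod k = j \<longleftrightarrow> i = j'" if "i < k" for i
    using that j k by (auto simp: j'_def mod_Suc)
  \<comment> \<open>Here \<open>k \<ge> 3\<close> enters: on two vertices the successor and the
    predecessor would coincide.\<close>
  have ne: "Suc j mod k \<noteq> j'" using j k by (auto simp: j'_def mod_Suc)
  have "{d \<in> C. v \<in> d} = {{v, vs ! (Suc j mod k)}, {vs ! j', v}}" (is "?L = ?R")
  proof
    show "?L \<subseteq> ?R"
    proof
      fix d assume "d \<in> ?L"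
      then obtain i where i: "i < k" "d = {vs ! i, vs ! (Suc i mod k)}" "v \<in> d"
        using C by blast
      hence "i = j \<or> Suc i mod k = j" using inj[OF j(1) i(1)] inj[OF j(1) lt] j(2) by auto
      thus "d \<in> ?R" using pred[OF i(1)] i(2) j(2) by auto
    qed
    have "Suc j' mod k = j" using pred[OF j'] by simp
    thus "?R \<subseteq> ?L" using C j j' by auto
  qed
  moreover have "{v, vs ! (Suc j mod k)} \<noteq> {vs ! j', v}"
    using inj[OF lt j'] ne by (auto simp: doubleton_eq_iff)
  ultimately show ?thesis by simp
qed

lemma inj_incidence_vector: "inj incidence_vector"
  by (auto simp: inj_def incidence_vector_def fun_eq_iff split: if_splits)

text \<open>A simple cycle outside the span could be adjoined to \<open>B\<close> without losing
  independence, against maximality.\<close>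

lemma cycle_basis_span:
  assumes "cycle_basis V E B" "simple_cycle V E C"
  shows "incidence_vector C \<in> gf2.span (incidence_vector ` B)"
proof (rule ccontr)
  assume n: "\<not> ?thesis"
  have "independent_cycles V E (insert C B)"
    using assms gf2.independent_insertI[OF n]
    unfolding cycle_basis_def independent_cycles_def image_insert by blast
  hence "insert C B = B" using assms(1) unfolding cycle_basis_def by blast
  hence "incidence_vector C \<in> incidence_vector ` B" by blast
  thus False using n gf2.span_base[of "incidence_vector C"] by metis
qed

lemma cycle_basisI:
  assumes "independent_cycles V E D"
    and "\<And>C. simple_cycle V E C \<Longrightarrow> incidence_vector C \<in> gf2.span (incidence_vector ` D)"
  shows "cycle_basis V E D"
  unfolding cycle_basis_def
proof (intro conjI allI impI assms(1))
  fix B' assume B': "independent_cycles V E B' \<and> D \<subseteq> B'"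
  show "B' = D"
  proof (rule ccontr)
    assume "B' \<noteq> D"
    then obtain C where C: "C \<in> B'" "C \<notin> D" using B' by blast
    have "incidence_vector C \<in> gf2.span (incidence_vector ` D)"
      using B' C assms(2) unfolding independent_cycles_def by blast
    \<comment> \<open>Injectivity guarantees that deleting the vector of \<open>C\<close> deletes no
      vector of \<open>D\<close>.\<close>
    moreover have "incidence_vector ` D \<subseteq> incidence_vector ` B' - {incidence_vector C}"
      using B' C by (auto dest: injD[OF inj_incidence_vector])
    ultimately have "incidence_vector C \<in> gf2.span (incidence_vector ` B' - {incidence_vector C})"
      using gf2.span_mono by blast
    thus False using B' C unfolding independent_cycles_def gf2.dependent_def by blast
  qed
qed

text \<open>Steinitz exchange, carried over from vectors to cycles by injectivity of
  \<open>incidence_vector\<close>.\<close>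

lemma card_cycle_basis_ge:
  assumes "cycle_basis V E B" "independent_cycles V E D" "finite B"
  shows "card D \<le> card B"
proof -
  have "incidence_vector ` D \<subseteq> gf2.span (incidence_vector ` B)"
    using assms cycle_basis_span unfolding independent_cycles_def by blast
  hence "card (incidence_vector ` D) \<le> card (incidence_vector ` B)"
    using gf2.independent_span_bound assms unfolding independent_cycles_def by blast
  thus ?thesis by (simp add: card_image inj_on_subset[OF inj_incidence_vector])
qed

subsection \<open>The graph\<close>

text \<open>Here \<open>s = 0\<close>, \<open>t = n\<close>, and \<open>n + k\<close> is the midpoint of the two-edge path \<open>Q\<^sub>k\<close> for \<open>1 \<le> k \<le> n\<close>;
  index \<open>0\<close> stands for the long path.\<close>

definition strand :: "nat \<Rightarrow> nat \<Rightarrow> nat edge set" where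
  "strand n k = (if k = 0 then (\<lambda>i. {i, Suc i}) ` {..<n} else {{0, n + k}, {n, n + k}})"

text \<open>The edge of strand \<open>k\<close> at the source \<open>0\<close>. It serves as a
  marker for the whole strand, both in counting the strands of a cycle and in proving
  independence.\<close>

definition first_edge :: "nat \<Rightarrow> nat \<Rightarrow> nat edge" where
  "first_edge n k = (if k = 0 then {0, 1} else {0, n + k})"

definition strand_graph :: "nat \<Rightarrow> nat edge set" where
  "strand_graph n = (\<Union>k\<le>n. strand n k)"

text \<open>Midpoints are numbered above \<open>n\<close>, so the graph edges inside
  \<open>{..n}\<close> are exactly those of the long path.\<close>

definition strand_weight :: "nat \<Rightarrow> nat edge \<Rightarrow> real" where
  "strand_weight n e = (if e \<subseteq> {..n} then 0 else 1)"

definition strand_basis :: "nat \<Rightarrow> nat edge set set" where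
  "strand_basis n = (\<lambda>k. strand n 0 \<union> strand n k) ` {1..n}"

lemma strand_graph_cases:
  assumes "e \<in> strand_graph n"
  obtains (path) i where "i < n" "e = {i, Suc i}"
  | (left) k where "1 \<le> k" "k \<le> n" "e = {0, n + k}"
  | (right) k where "1 \<le> k" "k \<le> n" "e = {n, n + k}"
proof -
  obtain k where "k \<le> n" "e \<in> strand n k" using assms unfolding strand_graph_def by blast
  thus thesis using path left[of k] right[of k] by (cases "k = 0") (auto simp: strand_def)
qed

lemma finite_strand_graph: "finite (strand_graph n)"
  unfolding strand_graph_def by (auto simp: strand_def)

lemma simple_graph_strand_graph:
  assumes "n \<ge> 1" shows "simple_graph {..2*n} (strand_graph n)"
  unfolding simple_graph_def using assms by (auto elim!: strand_graph_cases)

lemma first_edge_in_strand: "n \<ge> 1 \<Longrightarrow> first_edge n k \<in> strand n k"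
  by (force simp: first_edge_def strand_def)

lemma strand_disjoint: "j \<noteq> k \<Longrightarrow> strand n j \<inter> strand n k = {}"
  by (auto simp: strand_def doubleton_eq_iff)

lemma first_edge_in_strand_iff:
  assumes "n \<ge> 1" shows "first_edge n j \<in> strand n k \<longleftrightarrow> j = k"
  using first_edge_in_strand[OF assms, of j] strand_disjoint[of j k n] by blast

lemma inj_first_edge: "n \<ge> 1 \<Longrightarrow> inj (first_edge n)"
  by (auto simp: inj_def first_edge_def doubleton_eq_iff split: if_splits)

text \<open>Each strand has one edge at \<open>0\<close>, so the degree of a cycle at
  \<open>0\<close> will count its strands.\<close>

lemma edges_at_source:
  assumes "n \<ge> 1"
  shows "{e \<in> strand_graph n. 0 \<in> e} = first_edge n ` {..n}"
proof
  show "first_edge n ` {..n} \<subseteq> {e \<in> strand_graph n. 0 \<in> e}"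
  proof clarify
    fix k assume "k \<le> n"
    thus "first_edge n k \<in> strand_graph n \<and> 0 \<in> first_edge n k"
      using first_edge_in_strand[OF assms, of k] unfolding strand_graph_def
      by (auto simp: first_edge_def)
  qed
  show "{e \<in> strand_graph n. 0 \<in> e} \<subseteq> first_edge n ` {..n}"
  proof clarify
    fix e assume "e \<in> strand_graph n" "0 \<in> e"
    thus "e \<in> first_edge n ` {..n}"
    proof (cases rule: strand_graph_cases)
      case (path i)
      hence "e = first_edge n 0" using \<open>0 \<in> e\<close> by (auto simp: first_edge_def)
      thus ?thesis by blast
    next
      case (left k)
      hence "e = first_edge n k" by (auto simp: first_edge_def)
      thus ?thesis using left by blast
    next
      case (right k)
      thus ?thesis using \<open>0 \<in> e\<close> assms by auto
    qed
  qed
qed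

subsection \<open>Classification of the simple cycles\<close>

text \<open>Inner vertices of a strand have degree two in the graph, so a cycle entering a strand
  must follow it to the end.\<close>

lemma simple_cycle_strand:
  assumes C: "simple_cycle V (strand_graph n) C" and k: "k \<le> n"
    and e: "e \<in> strand n k"
  shows "e \<in> C \<longleftrightarrow> first_edge n k \<in> C"
proof -
  have sub: "C \<subseteq> strand_graph n" using C unfolding simple_cycle_def by auto
  \<comment> \<open>If \<open>a\<close> and \<open>b\<close> are the only possible edges at
    \<open>v\<close>, a cycle using just one of them would have degree 1 there.\<close>
  have pair: "a \<in> C \<longleftrightarrow> b \<in> C"
    if v: "{d \<in> strand_graph n. v \<in> d} \<subseteq> {a, b}" "v \<in> a" "v \<in> b" for v a b
  proof (rule ccontr)
    assume "\<not> ?thesis"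
    then obtain c where "c \<in> C" "v \<in> c" "{a, b} \<inter> C = {c}" using v(2,3) by auto
    moreover have "{d \<in> C. v \<in> d} \<subseteq> {a, b} \<inter> C" using v(1) sub by auto
    ultimately have c: "{d \<in> C. v \<in> d} = {c}" "c \<in> C" "v \<in> c" by auto
    thus False using simple_cycle_degree[OF C c(2,3)] by (simp add: c(1))
  qed
  show ?thesis
  proof (cases "k = 0")
    case False
    have "{d \<in> strand_graph n. n + k \<in> d} \<subseteq> {{0, n + k}, {n, n + k}}"
      using False k by (auto elim!: strand_graph_cases)
    hence "{0, n + k} \<in> C \<longleftrightarrow> {n, n + k} \<in> C" by (rule pair) auto
    thus ?thesis using e False by (auto simp: strand_def first_edge_def)
  next
    case True
    have "{i, Suc i} \<in> C \<longleftrightarrow> {0, 1} \<in> C" if "i < n" for i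
      using that
    proof (induction i)
      case (Suc i)
      have "{d \<in> strand_graph n. Suc i \<in> d} \<subseteq> {{i, Suc i}, {Suc i, Suc (Suc i)}}"
        using Suc.prems by (auto elim!: strand_graph_cases)
      hence "{i, Suc i} \<in> C \<longleftrightarrow> {Suc i, Suc (Suc i)} \<in> C" by (rule pair) auto
      thus ?case using Suc by simp
    qed simp
    thus ?thesis using e True by (auto simp: strand_def first_edge_def)
  qed
qed

text \<open>A cycle is the union of the strands whose first edges it contains; their number is its
  degree at \<open>0\<close>, which is 2.\<close>

lemma simple_cycle_two_strands:
  assumes n: "n \<ge> 1" and C: "simple_cycle V (strand_graph n) C"
  obtains j k where "j < k" "k \<le> n" "C = strand n j \<union> strand n k"
proof -
  have sub: "C \<subseteq> strand_graph n" using C unfolding simple_cycle_def by auto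
  have "C \<noteq> {}"
    using C unfolding simple_cycle_def closed_walk_edges_def by fastforce
  define K where "K = {k. k \<le> n \<and> first_edge n k \<in> C}"
  have CK: "C = (\<Union>k\<in>K. strand n k)"
  proof -
    note iff = simple_cycle_strand[OF C]
    have "e \<in> (\<Union>k\<in>K. strand n k)" if e: "e \<in> C" for e
    proof -
      obtain k where k: "k \<le> n" "e \<in> strand n k" using e sub unfolding strand_graph_def by blast
      hence "k \<in> K" using iff[OF k] e unfolding K_def by simp
      thus ?thesis using k(2) by (rule UN_I)
    qed
    moreover have "e \<in> C" if "k \<in> K" "e \<in> strand n k" for k e
      using that iff[of k e] unfolding K_def by simp
    ultimately show ?thesis by blast
  qed
  have im: "{d \<in> C. 0 \<in> d} = first_edge n ` K"
  proof -
    have "{d \<in> C. 0 \<in> d} = {d \<in> strand_graph n. 0 \<in> d} \<inter> C" using sub by auto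
    thus ?thesis unfolding edges_at_source[OF n] K_def by auto
  qed
  \<comment> \<open>A nonempty cycle contains some strand and hence passes through \<open>0\<close>,
    so the degree lemma applies there.\<close>
  obtain k where "k \<in> K" using \<open>C \<noteq> {}\<close> CK by blast
  hence "first_edge n k \<in> C" "0 \<in> first_edge n k" by (auto simp: K_def first_edge_def)
  hence "card (first_edge n ` K) = 2" using simple_cycle_degree[OF C] im by metis
  hence "card K = 2" using inj_first_edge[OF n] by (simp add: card_image inj_on_subset)
  then obtain a b where ab: "K = {a, b}" "a \<noteq> b" by (auto simp: card_2_iff)
  show thesis
  proof (cases "a < b")
    case True
    thus ?thesis using that[of a b] ab CK unfolding K_def by auto
  next
    case False
    thus ?thesis using that[of b a] ab CK unfolding K_def by auto
  qed
qed

section \<open>The cycles through the long path form a cycle basis\<close>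

lemma simple_cycle_strand_basis:
  assumes "n \<ge> 1" "C \<in> strand_basis n"
  shows "simple_cycle {..2*n} (strand_graph n) C"
proof -
  obtain k where k: "1 \<le> k" "k \<le> n" "C = strand n 0 \<union> strand n k"
    using assms unfolding strand_basis_def by auto
  define vs where "vs = [0..<Suc n] @ [n + k]"
  have "closed_walk_edges vs = C"
  proof -
    have len: "length vs = n + 2" by (simp add: vs_def)
    have "closed_walk_edges vs = (\<lambda>i. {vs ! i, vs ! (Suc i mod (n + 2))}) ` {..<n+2}"
      unfolding closed_walk_edges_def len by blast
    \<comment> \<open>The indices \<open>n\<close> and \<open>Suc n\<close> give the two edges at
      the midpoint; at \<open>Suc n\<close> the walk wraps around to \<open>0\<close>.\<close>
    also have "{..<n+2} = insert (Suc n) (insert n {..<n})" by auto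
    also have "(\<lambda>i. {vs ! i, vs ! (Suc i mod (n + 2))}) ` \<dots> =
        insert {n + k, 0} (insert {n, n + k} ((\<lambda>i. {i, Suc i}) ` {..<n}))"
    proof -
      have "vs ! i = i" if "i \<le> n" for i
        using that unfolding vs_def by (simp add: nth_append del: upt_Suc)
      moreover have "vs ! Suc n = n + k" unfolding vs_def by (simp add: nth_append del: upt_Suc)
      ultimately show ?thesis by (auto simp: image_iff)
    qed
    also have "\<dots> = C" using k by (auto simp: strand_def)
    finally show ?thesis .
  qed
  moreover have "C \<subseteq> strand_graph n" using k unfolding strand_graph_def by auto
  moreover have "distinct vs" "set vs \<subseteq> {..2*n}" "length vs \<ge> 3"
    using k assms by (auto simp: vs_def)
  ultimately show ?thesis unfolding simple_cycle_def by metis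
qed

lemma card_strand_basis: "n \<ge> 1 \<Longrightarrow> card (strand_basis n) = n"
proof -
  assume n: "n \<ge> 1"
  have "inj_on (\<lambda>k. strand n 0 \<union> strand n k) {1..n}"
  proof (rule inj_onI)
    fix j k assume "j \<in> {1..n}" "k \<in> {1..n}" "strand n 0 \<union> strand n j = strand n 0 \<union> strand n k"
    thus "j = k"
      using first_edge_in_strand_iff[OF n, of j k] first_edge_in_strand_iff[OF n, of j 0]
        first_edge_in_strand[OF n, of j] by auto
  qed
  thus ?thesis unfolding strand_basis_def by (simp add: card_image)
qed

lemma independent_strand_basis:
  assumes n: "n \<ge> 1"
  shows "independent_cycles {..2*n} (strand_graph n) (strand_basis n)"
  unfolding independent_cycles_def
proof (intro conjI ballI)
  show "simple_cycle {..2*n} (strand_graph n) C" if "C \<in> strand_basis n" for C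
    using simple_cycle_strand_basis[OF n that] .
  show "gf2.independent (incidence_vector ` strand_basis n)"
    unfolding gf2.dependent_def
  proof clarify
    fix C assume "C \<in> strand_basis n" and
      *: "incidence_vector C \<in> gf2.span (incidence_vector ` strand_basis n - {incidence_vector C})"
    then obtain k where k: "k \<in> {1..n}" "C = strand n 0 \<union> strand n k"
      unfolding strand_basis_def by blast
    \<comment> \<open>The edge \<open>first_edge n k\<close> belongs to no other cycle of the
      family, so this hyperplane contains all the other vectors but not that of
      \<open>C\<close>.\<close>
    let ?U = "{x. x (first_edge n k) = (0::bit)}"
    have sub: "gf2.subspace ?U" by (rule gf2.subspaceI) auto
    have "incidence_vector ` strand_basis n - {incidence_vector C} \<subseteq> ?U"
      using k first_edge_in_strand_iff[OF n]
      by (auto simp: strand_basis_def incidence_vector_def)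
    hence "incidence_vector C \<in> ?U" using * gf2.span_minimal[OF _ sub] by blast
    thus False using k first_edge_in_strand[OF n] by (simp add: incidence_vector_def)
  qed
qed

text \<open>Over GF(2) the long path cancels: Q_j \<union> Q_k is the sum of P \<union> Q_j and P
  \<union> Q_k.\<close>

lemma cycle_basis_strand_basis:
  assumes n: "n \<ge> 1"
  shows "cycle_basis {..2*n} (strand_graph n) (strand_basis n)"
proof (rule cycle_basisI[OF independent_strand_basis[OF n]])
  fix C assume "simple_cycle {..2*n} (strand_graph n) C"
  then obtain j k where jk: "j < k" "k \<le> n" "C = strand n j \<union> strand n k"
    using simple_cycle_two_strands[OF n] by blast
  let ?S = "gf2.span (incidence_vector ` strand_basis n)"
  have S: "incidence_vector (strand n 0 \<union> strand n i) \<in> ?S" if "1 \<le> i" "i \<le> n" for i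
    using that by (intro gf2.span_base) (auto simp: strand_basis_def)
  show "incidence_vector C \<in> ?S"
  proof (cases "j = 0")
    case True
    thus ?thesis using S[of k] jk by simp
  next
    case False
    have "incidence_vector C =
        incidence_vector (strand n 0 \<union> strand n j) + incidence_vector (strand n 0 \<union> strand n k)"
      using strand_disjoint[of 0 j n] strand_disjoint[of 0 k n] strand_disjoint[of j k n] jk False
      by (auto simp: incidence_vector_def fun_eq_iff)
    moreover have "\<dots> \<in> ?S" using S[of j] S[of k] jk False by (intro gf2.span_add) linarith+
    ultimately show ?thesis by metis
  qed
qed

section \<open>Weights, lengths and uniqueness of the minimum cycle basis\<close>

text \<open>For \<open>n = 0\<close> both edges of a strand \<open>k \<ge> 1\<close> collapse into
  one of weight 1; \<open>min k 1\<close> covers this case together with the weightless strand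
  \<open>0\<close>.\<close>

lemma strand_weight_strand:
  "(\<Sum>e\<in>strand n k. strand_weight n e) = (if k = 0 \<or> n = 0 then real (min k 1) else 2)"
  by (auto simp: strand_def strand_weight_def doubleton_eq_iff intro!: sum.neutral)

lemma finite_strand: "finite (strand n k)"
  by (simp add: strand_def)

lemma strand_weight_two_strands:
  assumes "n \<ge> 1" "j < k"
  shows "(\<Sum>e\<in>strand n j \<union> strand n k. strand_weight n e) = (if j = 0 then 2 else 4)"
  using assms strand_disjoint[of j k n]
  by (simp add: sum.union_disjoint finite_strand strand_weight_strand)

lemma card_strand_basis_cycle:
  assumes "n \<ge> 1" "C \<in> strand_basis n"
  shows "card C = n + 2"
proof -
  obtain k where k: "1 \<le> k" "k \<le> n" "C = strand n 0 \<union> strand n k"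
    using assms unfolding strand_basis_def by auto
  have "card (strand n 0) = n"
    by (simp add: strand_def card_image inj_on_def doubleton_eq_iff)
  moreover have "card (strand n k) = 2"
    using k by (simp add: strand_def doubleton_eq_iff)
  ultimately show ?thesis
    using k strand_disjoint[of 0 k n] by (simp add: card_Un_disjoint finite_strand)
qed

text \<open>A basis has at least \<open>n\<close> cycles, each of weight 2 inside
  \<open>strand_basis n\<close> and 4 outside. A total of at most \<open>2 * n\<close> leaves no
  room for the latter, and counting then gives equality.\<close>

lemma minimum_cycle_basis_strand_graph:
  assumes n: "n \<ge> 1" and B: "minimum_cycle_basis {..2*n} (strand_graph n) (strand_weight n) B"
  shows "B = strand_basis n"
proof -
  let ?D = "strand_basis n" and ?w = "\<lambda>C. \<Sum>e\<in>C. strand_weight n e"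
  have cb: "cycle_basis {..2*n} (strand_graph n) B"
    using B by (simp add: minimum_cycle_basis_def)
  hence cyc: "simple_cycle {..2*n} (strand_graph n) C" if "C \<in> B" for C
    using that unfolding cycle_basis_def independent_cycles_def by blast
  have "B \<subseteq> Pow (strand_graph n)" using cyc unfolding simple_cycle_def by blast
  hence fin: "finite B" using finite_strand_graph finite_subset by blast
  have card: "n \<le> card B"
    using card_cycle_basis_ge[OF cb independent_strand_basis[OF n] fin] card_strand_basis[OF n]
    by simp
  have wD: "?w C = 2" if "C \<in> ?D" for C
    using that strand_weight_two_strands[OF n, of 0] by (auto simp: strand_basis_def)
  have wB: "?w C = (if C \<in> ?D then 2 else 4)" if C: "C \<in> B" for C
  proof -
    obtain j k where jk: "j < k" "k \<le> n" "C = strand n j \<union> strand n k"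
      using simple_cycle_two_strands[OF n cyc[OF C]] by blast
    show ?thesis
    proof (cases "j = 0")
      case True
      hence "C \<in> ?D" using jk by (auto simp: strand_basis_def)
      thus ?thesis using wD by simp
    next
      case False
      \<comment> \<open>Weight 4 itself excludes \<open>C\<close> from
        \<open>strand_basis n\<close>, whose members all weigh 2.\<close>
      hence "?w C = 4" using strand_weight_two_strands[OF n jk(1)] jk(3) by simp
      thus ?thesis using wD[of C] by auto
    qed
  qed
  have "total_weight (strand_weight n) B \<le> total_weight (strand_weight n) ?D"
    using B cycle_basis_strand_basis[OF n] unfolding minimum_cycle_basis_def by blast
  also have "\<dots> = 2 * real n"
    unfolding total_weight_def using wD card_strand_basis[OF n] by simp
  finally have "(\<Sum>C\<in>B. if C \<in> ?D then 2 else 4 :: real) \<le> 2 * real n"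
    unfolding total_weight_def using wB by (simp cong: sum.cong)
  \<comment> \<open>Splitting off 2 per cycle leaves an excess of 2 for each cycle outside
    \<open>strand_basis n\<close>.\<close>
  moreover have "(\<Sum>C\<in>B. if C \<in> ?D then 2 else 4 :: real) =
      (\<Sum>C\<in>B. 2 + (if C \<in> ?D then 0 else 2))"
    by (rule sum.cong) auto
  moreover have "\<dots> = 2 * real (card B) + 2 * real (card (B - ?D))"
    using fin by (simp add: sum.distrib sum.If_cases Diff_eq)
  ultimately have "card (B - ?D) = 0" using card by linarith
  hence "B \<subseteq> ?D" using fin by auto
  thus ?thesis using card card_strand_basis[OF n] card_seteq[of ?D B]
    by (simp add: strand_basis_def)
qed

subsection \<open>Planarity\<close>

text \<open>The long path occupies [0, 2n] on the real axis. The midpoint of Q_k sits above its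
  centre at height k n, so the Q_k are nested tents with slopes k and -k.\<close>

definition strand_pos :: "nat \<Rightarrow> nat \<Rightarrow> complex" where
  "strand_pos n v = (if v \<le> n then Complex (2 * real v) 0
                     else Complex (real n) ((real v - real n) * real n))"

text \<open>Edges are unordered, so \<open>Min\<close> and \<open>Max\<close> fix an orientation of
  the segment.\<close>

definition strand_curve :: "nat \<Rightarrow> nat edge \<Rightarrow> real \<Rightarrow> complex" where
  "strand_curve n e = linepath (strand_pos n (Min e)) (strand_pos n (Max e))"

lemma inj_strand_pos: "n \<ge> 1 \<Longrightarrow> inj (strand_pos n)"
  by (auto simp: inj_def strand_pos_def split: if_splits)

text \<open>This and the next two lemmas confine each segment to a line and a range of
  \<open>Re z\<close>, reducing intersections to arithmetic.\<close>

lemma path_image_path: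
  assumes "i < n" "z \<in> path_image (strand_curve n {i, Suc i})"
  shows "Im z = 0 \<and> 2 * real i \<le> Re z \<and> Re z \<le> 2 * real i + 2"
proof -
  obtain u where "0 \<le> u" "u \<le> 1" "z = (1 - u) *\<^sub>R strand_pos n i + u *\<^sub>R strand_pos n (Suc i)"
    using assms by (auto simp: strand_curve_def in_segment)
  thus ?thesis using assms(1) by (auto simp: strand_pos_def complex_eq_iff algebra_simps)
qed

lemma path_image_left:
  assumes "1 \<le> k" "n \<ge> 1" "z \<in> path_image (strand_curve n {0, n + k})"
  shows "Im z = real k * Re z \<and> 0 \<le> Re z \<and> Re z \<le> real n"
proof -
  obtain u where "0 \<le> u" "u \<le> 1" "z = (1 - u) *\<^sub>R strand_pos n 0 + u *\<^sub>R strand_pos n (n + k)"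
    using assms(3) by (auto simp: strand_curve_def in_segment)
  thus ?thesis using assms(1,2) by (auto simp: strand_pos_def complex_eq_iff algebra_simps mult_left_le)
qed

lemma path_image_right:
  assumes "1 \<le> k" "n \<ge> 1" "z \<in> path_image (strand_curve n {n, n + k})"
  shows "Im z = real k * (2 * real n - Re z) \<and> real n \<le> Re z \<and> Re z \<le> 2 * real n"
proof -
  obtain u where "0 \<le> u" "u \<le> 1" "z = (1 - u) *\<^sub>R strand_pos n n + u *\<^sub>R strand_pos n (n + k)"
    using assms(3) by (auto simp: strand_curve_def in_segment)
  hence u: "0 \<le> u" "u \<le> 1" and z: "Re z = (2 - u) * real n" "Im z = u * real k * real n"
    using assms(1,2) by (auto simp: strand_pos_def complex_eq_iff algebra_simps)
  have "1 * real n \<le> (2 - u) * real n" "(2 - u) * real n \<le> 2 * real n"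
    using u by (intro mult_right_mono; simp)+
  thus ?thesis unfolding z by (simp add: algebra_simps)
qed

lemma strand_curve_endpoints:
  assumes "e \<in> strand_graph n"
  shows "{pathstart (strand_curve n e), pathfinish (strand_curve n e)} = strand_pos n ` e"
  using assms by (auto elim!: strand_graph_cases simp: strand_curve_def)

text \<open>Equating the two line descriptions forces \<open>Re z\<close> to an end of
  \<open>e\<close>, and \<open>Im z\<close> follows. The conclusion concerns \<open>e\<close> alone;
  exchanging the edges gives it for \<open>e'\<close>.\<close>

lemma strand_curve_meet:
  assumes n: "n \<ge> 1" and e: "e \<in> strand_graph n" and e': "e' \<in> strand_graph n" and ne: "e \<noteq> e'"
    and z: "z \<in> path_image (strand_curve n e)" and z': "z \<in> path_image (strand_curve n e')"
  shows "z \<in> strand_pos n ` e"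
  using e
proof (cases rule: strand_graph_cases)
  case (path i)
  note p = path_image_path[OF path(1) z[unfolded path(2)]]
  have "Re z = 2 * real i \<or> Re z = 2 * real i + 2"
    using e'
  proof (cases rule: strand_graph_cases)
    case path': (path j)
    note p' = path_image_path[OF path'(1) z'[unfolded path'(2)]]
    have "i \<noteq> j" using ne path(2) path'(2) by auto
    \<comment> \<open>The intervals [2i, 2i+2] and [2j, 2j+2] share at most an endpoint.\<close>
    hence "real i + 1 \<le> real j \<or> real j + 1 \<le> real i" by linarith
    thus ?thesis using p p' by linarith
  next
    case (left k)
    hence "real k * Re z = 0" using path_image_left[OF left(1) n z'[unfolded left(3)]] p by simp
    thus ?thesis using p left by simp
  next
    case (right k)
    hence "real k * (2 * real n - Re z) = 0"
      using path_image_right[OF right(1) n z'[unfolded right(3)]] p by simp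
    moreover have "real i + 1 \<le> real n" using path by linarith
    ultimately show ?thesis using p right by (auto; linarith)
  qed
  thus ?thesis using p path by (auto simp: strand_pos_def complex_eq_iff)
next
  case (left k)
  note p = path_image_left[OF left(1) n z[unfolded left(3)]]
  have "Re z = 0 \<or> Re z = real n"
    using e'
  proof (cases rule: strand_graph_cases)
    case (path j)
    hence "real k * Re z = 0" using path_image_path[OF path(1) z'[unfolded path(2)]] p by simp
    thus ?thesis using left by simp
  next
    case left': (left j)
    \<comment> \<open>Two lines through the origin with distinct slopes meet only there.\<close>
    have "real k * Re z = real j * Re z"
      using path_image_left[OF left'(1) n z'[unfolded left'(3)]] p by simp
    thus ?thesis using ne left left' by auto
  next
    case (right j)
    \<comment> \<open>The left and right halves of the tents share only the vertical line
      \<open>Re z = real n\<close>.\<close>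
    show ?thesis using path_image_right[OF right(1) n z'[unfolded right(3)]] p by linarith
  qed
  thus ?thesis using p left n by (auto simp: strand_pos_def complex_eq_iff)
next
  case (right k)
  note p = path_image_right[OF right(1) n z[unfolded right(3)]]
  have "Re z = 2 * real n \<or> Re z = real n"
    using e'
  proof (cases rule: strand_graph_cases)
    case (path j)
    hence "real k * (2 * real n - Re z) = 0"
      using path_image_path[OF path(1) z'[unfolded path(2)]] p by simp
    thus ?thesis using right by simp
  next
    case (left j)
    show ?thesis using path_image_left[OF left(1) n z'[unfolded left(3)]] p by linarith
  next
    case right': (right j)
    have "real k * (2 * real n - Re z) = real j * (2 * real n - Re z)"
      using path_image_right[OF right'(1) n z'[unfolded right'(3)]] p by simp
    thus ?thesis using ne right right' by auto
  qed
  thus ?thesis using p right n by (auto simp: strand_pos_def complex_eq_iff)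
qed

lemma strand_curve_contains_ends:
  assumes "e \<in> strand_graph n"
  shows "strand_pos n ` e \<subseteq> path_image (strand_curve n e)"
  unfolding strand_curve_endpoints[OF assms, symmetric]
  by (simp add: pathstart_in_path_image pathfinish_in_path_image)

text \<open>Every vertex is an end of some edge \<open>e'\<close>. If \<open>v\<close> is not in
  \<open>e\<close>, then \<open>e'\<close> differs from \<open>e\<close>, and the meeting lemma
  makes the point of \<open>v\<close> an end of \<open>e\<close>, contradicting injectivity.\<close>

lemma strand_curve_vertex:
  assumes n: "n \<ge> 1" and e: "e \<in> strand_graph n" and v: "v \<le> 2 * n"
    and z: "strand_pos n v \<in> path_image (strand_curve n e)"
  shows "v \<in> e"
proof (rule ccontr)
  assume "v \<notin> e"
  obtain e' where e': "e' \<in> strand_graph n" "v \<in> e'"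
  proof -
    consider "v < n" | "v = n" | "n < v" by linarith
    thus thesis
    proof cases
      case 1
      hence "{v, Suc v} \<in> strand n 0" by (auto simp: strand_def)
      thus ?thesis using that unfolding strand_graph_def by blast
    next
      case 2
      hence "{n, n + 1} \<in> strand n 1" by (auto simp: strand_def)
      thus ?thesis using that[of "{n, n + 1}"] n 2 unfolding strand_graph_def by blast
    next
      case 3
      hence "{0, v} \<in> strand n (v - n)" by (auto simp: strand_def)
      moreover have "v - n \<le> n" using v by simp
      ultimately show ?thesis using that[of "{0, v}"] unfolding strand_graph_def by blast
    qed
  qed
  have "strand_pos n v \<in> strand_pos n ` e"
    using strand_curve_meet[OF n e e'(1) _ z] strand_curve_contains_ends[OF e'(1)] e' \<open>v \<notin> e\<close>
    by blast
  thus False using inj_strand_pos[OF n] \<open>v \<notin> e\<close> by (auto dest: injD)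
qed

lemma planar_strand_graph:
  assumes n: "n \<ge> 1"
  shows "planar {..2*n} (strand_graph n)"
proof -
  have sub: "e \<subseteq> {..2*n}" "card e = 2" if "e \<in> strand_graph n" for e
    using that simple_graph_strand_graph[OF n] unfolding simple_graph_def by auto
  have "plane_embedding {..2*n} (strand_graph n) (strand_pos n) (strand_curve n)"
    unfolding plane_embedding_def
  proof (intro conjI ballI impI)
    show "inj_on (strand_pos n) {..2*n}"
      using inj_strand_pos[OF n] inj_on_subset by blast
  next
    fix e assume e: "e \<in> strand_graph n"
    have "Min e \<noteq> Max e" using e n by (auto elim!: strand_graph_cases)
    thus "arc (strand_curve n e)"
      unfolding strand_curve_def using inj_strand_pos[OF n] by (intro arc_linepath) (auto dest: injD)
    show "{pathstart (strand_curve n e), pathfinish (strand_curve n e)} = strand_pos n ` e"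
      using strand_curve_endpoints[OF e] .
    show "path_image (strand_curve n e) \<inter> strand_pos n ` {..2*n} = strand_pos n ` e"
      using strand_curve_contains_ends[OF e] sub[OF e] strand_curve_vertex[OF n e] by blast
  next
    fix e e' assume e: "e \<in> strand_graph n" "e' \<in> strand_graph n" "e \<noteq> e'"
    \<comment> \<open>The meeting lemma is used in both orders, once for each edge.\<close>
    have "path_image (strand_curve n e) \<inter> path_image (strand_curve n e')
        = strand_pos n ` e \<inter> strand_pos n ` e'"
      using strand_curve_meet[OF n] e strand_curve_contains_ends by blast
    thus "path_image (strand_curve n e) \<inter> path_image (strand_curve n e') = strand_pos n ` (e \<inter> e')"
      using inj_strand_pos[OF n] by (simp add: image_Int)
  qed
  thus ?thesis unfolding planar_def by blast
qed

theorem theorem1: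
  "\<exists>c::real. c > 0 \<and>
     (\<forall>N::nat. \<exists>(V :: nat set) (E :: nat edge set) (w :: nat edge \<Rightarrow> real).
        simple_graph V E \<and> planar V E \<and> card V \<ge> N \<and>
        (\<forall>B. minimum_cycle_basis V E w B \<longrightarrow>
             real (total_length B) \<ge> c * (real (card V))\<^sup>2))"
proof (intro exI[of _ "1/4"] conjI allI)
  fix N :: nat
  \<comment> \<open>This choice gives both \<open>n \<ge> 1\<close> and 2n + 1 \<ge> N
    vertices.\<close>
  define n where "n = Suc N"
  have n: "n \<ge> 1" by (simp add: n_def)
  have "real (total_length B) \<ge> 1/4 * (real (card {..2*n}))\<^sup>2"
    if "minimum_cycle_basis {..2*n} (strand_graph n) (strand_weight n) B" for B
  proof -
    have "total_length B = n * (n + 2)"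
      unfolding minimum_cycle_basis_strand_graph[OF n that] total_length_def
      using card_strand_basis[OF n] card_strand_basis_cycle[OF n] by simp
    \<comment> \<open>The constant 1/4 works since (2n+1)^2 / 4 = n^2 + n + 1/4 \<le> n^2 + 2n for n
      \<ge> 1.\<close>
    thus ?thesis using n by (simp add: power2_eq_square field_simps)
  qed
  moreover have "card {..2*n} \<ge> N" by (simp add: n_def)
  ultimately show "\<exists>(V :: nat set) E w. simple_graph V E \<and> planar V E \<and> card V \<ge> N \<and>
      (\<forall>B. minimum_cycle_basis V E w B \<longrightarrow> real (total_length B) \<ge> 1/4 * (real (card V))\<^sup>2)"
    using simple_graph_strand_graph[OF n] planar_strand_graph[OF n] by blast
qed simp

end
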